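(* Let $k\geq1$ be an integer and let $G$ be a graph of order $n$ and size $m$ with $\delta(G)\geq k-1$. Then $$d_{\times k}(G)\leq\frac12+\sqrt{\frac14+\frac{2m-(k-1)n}{k\,\gamma_{\times k}(G)}}.$$ Moreover, equality holds if and only if $G\in\Psi$.
   Context: For a graph $G$ with $\delta(G)\geq k-1$, a $k$-tuple dominating set is a set $S\subseteq V(G)$ with $|N[v]\cap S|\geq k$ for all $v\in V(G)$ ($N[v]$ the closed neighborhood); $\gamma_{\times k}(G)$ is its minimum cardinality. A $k$-tuple domatic partition is a partition of $V(G)$ each of whose parts is a $k$-tuple dominating set; $d_{\times k}(G)$ is the maximum number of parts of such a partition. The family $\Psi$: take $(k-1)$-regular graphs $H_1,\dots,H_r$ all of the same order, and form $G$ from their disjoint union by joining each vertex of $H_i$ to precisely $k$ vertices of $H_j$, for all $1\leq i\neq j\leq r$; $\Psi$ is the family of all such graphs $G$. *)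

theory Defs
  imports Complex_Main "HOL-Library.Disjoint_Sets" "Graph_Theory.Pair_Digraph"
begin

text \<open>
  Finite simple undirected graphs are the \<^locale>\<open>pair_graph\<close>s of the library: finite,
  loop-free digraphs whose arc set (a set of vertex pairs) is symmetric. An undirected edge
  therefore corresponds to two opposite arcs, so the size is counted on unordered pairs.
\<close>

definition graph_order :: "'a pair_pre_digraph \<Rightarrow> nat" where
  "graph_order G = card (pverts G)"

definition graph_size :: "'a pair_pre_digraph \<Rightarrow> nat" where
  "graph_size G = card {{u, v} | u v. (u, v) \<in> parcs G}"

definition open_nbhd :: "'a pair_pre_digraph \<Rightarrow> 'a \<Rightarrow> 'a set" where
  "open_nbhd G v = {u. (v, u) \<in> parcs G}"

definition closed_nbhd :: "'a pair_pre_digraph \<Rightarrow> 'a \<Rightarrow> 'a set" where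
  "closed_nbhd G v = insert v (open_nbhd G v)"

definition degree :: "'a pair_pre_digraph \<Rightarrow> 'a \<Rightarrow> nat" where
  "degree G v = card (open_nbhd G v)"

definition min_degree :: "'a pair_pre_digraph \<Rightarrow> nat" where
  "min_degree G = Min (degree G ` pverts G)"

definition tuple_dominating :: "nat \<Rightarrow> 'a pair_pre_digraph \<Rightarrow> 'a set \<Rightarrow> bool" where
  "tuple_dominating k G S \<longleftrightarrow>
     S \<subseteq> pverts G \<and> (\<forall>v \<in> pverts G. card (closed_nbhd G v \<inter> S) \<ge> k)"

text \<open>
  For a nonempty graph with minimum degree at least \<open>k - 1\<close> the whole vertex set is a
  \<open>k\<close>-tuple dominating set, so the minimum and the maximum below are taken over finite
  nonempty sets.
\<close>

definition tuple_domination_number :: "nat \<Rightarrow> 'a pair_pre_digraph \<Rightarrow> nat" where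
  "tuple_domination_number k G = Min {card S | S. tuple_dominating k G S}"

definition tuple_domatic_partition :: "nat \<Rightarrow> 'a pair_pre_digraph \<Rightarrow> 'a set set \<Rightarrow> bool" where
  "tuple_domatic_partition k G P \<longleftrightarrow>
     partition_on (pverts G) P \<and> (\<forall>S \<in> P. tuple_dominating k G S)"

definition tuple_domatic_number :: "nat \<Rightarrow> 'a pair_pre_digraph \<Rightarrow> nat" where
  "tuple_domatic_number k G = Max {card P | P. tuple_domatic_partition k G P}"

definition regular_graph :: "nat \<Rightarrow> 'a pair_pre_digraph \<Rightarrow> bool" where
  "regular_graph d H \<longleftrightarrow>
     pair_graph H \<and> pverts H \<noteq> {} \<and> (\<forall>v \<in> pverts H. degree H v = d)"

text \<open>
  The graphs \<open>H 1, \<dots>, H r\<close> have disjoint vertex sets, and the arcs of \<open>G\<close> that are added to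
  their disjoint union run between different \<open>H i\<close>: inside the vertex set of \<open>H i\<close> the arcs of
  \<open>G\<close> are exactly those of \<open>H i\<close>.
\<close>

definition Psi_family :: "nat \<Rightarrow> 'a pair_pre_digraph set" where
  "Psi_family k = {G. pair_graph G \<and>
     (\<exists>(r::nat) (H :: nat \<Rightarrow> 'a pair_pre_digraph). r \<ge> 1 \<and>
        (\<forall>i \<in> {1..r}. regular_graph (k - 1) (H i)) \<and>
        (\<forall>i \<in> {1..r}. \<forall>j \<in> {1..r}. graph_order (H i) = graph_order (H j)) \<and>
        disjoint_family_on (\<lambda>i. pverts (H i)) {1..r} \<and>
        pverts G = (\<Union>i \<in> {1..r}. pverts (H i)) \<and>
        (\<forall>i \<in> {1..r}. parcs G \<inter> (pverts (H i) \<times> pverts (H i)) = parcs (H i)) \<and>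
        (\<forall>i \<in> {1..r}. \<forall>j \<in> {1..r}. i \<noteq> j \<longrightarrow>
           (\<forall>v \<in> pverts (H i). card (open_nbhd G v \<inter> pverts (H j)) = k)))}"

end

theory Submission
  imports Defs
begin

text \<open>
  Let \<open>P\<close> be a \<open>k\<close>-tuple domatic partition with \<open>d\<close> parts. Every closed neighbourhood meets every
  part in at least \<open>k\<close> vertices, so \<open>deg v + 1 \<ge> k d\<close>, and every part has at least \<open>\<gamma>\<close>
  vertices, so \<open>n \<ge> d \<gamma>\<close>. Summing over the vertices gives
  \<open>2 m - (k - 1) n \<ge> k n (d - 1) \<ge> k \<gamma> d (d - 1)\<close>, which is the bound solved for \<open>d\<close>.
  Equality forces every closed neighbourhood to meet every part in exactly \<open>k\<close> vertices and, if
  \<open>d \<ge> 2\<close>, all parts to have \<open>\<gamma>\<close> vertices; this describes the family \<open>\<Psi>\<close>. Conversely, a graph in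
  \<open>\<Psi>\<close> built from \<open>r\<close> pieces is regular of degree \<open>k r - 1\<close>, so that counting the pairs \<open>(v, s)\<close>
  with \<open>s \<in> N[v] \<inter> S\<close> shows that every \<open>k\<close>-tuple dominating set \<open>S\<close> has at least \<open>n / r\<close>
  elements, whence \<open>\<gamma> = n / r\<close> and \<open>d = r\<close>.
\<close>

section \<open>The quadratic in the number of parts, and counting along a partition\<close>

lemma le_half_plus_sqrt_iff:
  fixes d :: nat and x :: real
  assumes "d \<ge> 1"
  shows "real d \<le> 1/2 + sqrt (1/4 + x) \<longleftrightarrow> real d * (real d - 1) \<le> x"
    and "real d = 1/2 + sqrt (1/4 + x) \<longleftrightarrow> real d * (real d - 1) = x"
proof -
  \<comment> \<open>Completing the square: since d \<ge> 1, the number d - 1/2 is the nonnegative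
    root of 1/4 + d (d - 1). As \<open>sqrt\<close> is strictly increasing on all reals, comparing
    roots then amounts to comparing d (d - 1) with x.\<close>
  have "sqrt ((real d - 1/2)\<^sup>2) = real d - 1/2"
    using assms by simp
  then have d: "real d = 1/2 + sqrt (1/4 + real d * (real d - 1))"
    by (simp add: power2_eq_square algebra_simps)
  show "real d \<le> 1/2 + sqrt (1/4 + x) \<longleftrightarrow> real d * (real d - 1) \<le> x"
    by (subst d) simp
  show "real d = 1/2 + sqrt (1/4 + x) \<longleftrightarrow> real d * (real d - 1) = x"
    by (subst d) simp
qed

lemma card_Int_partition_on:
  assumes "finite A" "partition_on A P" "B \<subseteq> A"
  shows "card B = (\<Sum>S\<in>P. card (B \<inter> S))"
proof -
  have fin: "finite P"
    using assms(1,2) finite_elements by blast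
  have "B = (\<Union>S\<in>P. B \<inter> S)"
    using assms(2,3) by (auto dest: partition_onD1)
  then have "card B = card (\<Union>S\<in>P. B \<inter> S)"
    by simp
  also have "\<dots> = (\<Sum>S\<in>P. card (B \<inter> S))"
  proof (rule card_UN_disjoint[OF fin])
    show "\<forall>S\<in>P. finite (B \<inter> S)"
      using assms(1,3) finite_subset by blast
    show "\<forall>S\<in>P. \<forall>T\<in>P. S \<noteq> T \<longrightarrow> (B \<inter> S) \<inter> (B \<inter> T) = {}"
      using partition_onD2[OF assms(2)] by (auto simp: disjoint_def)
  qed
  finally show ?thesis .
qed

section \<open>Neighbourhoods, degree sums and double counting\<close>

context
  fixes G :: "'a pair_pre_digraph"
  assumes G: "pair_graph G"
begin

interpretation pair_graph G by (rule G)

lemma open_nbhd_subset: "open_nbhd G v \<subseteq> pverts G"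
  by (auto simp: open_nbhd_def dest: arc_snd_in_verts in_arcsD2)

lemma finite_open_nbhd: "finite (open_nbhd G v)"
  using open_nbhd_subset finite_subset pair_finite_verts by blast

lemma arc_sym: "(u, v) \<in> parcs G \<longleftrightarrow> (v, u) \<in> parcs G"
  using arcs_symmetric by blast

lemma not_in_open_nbhd: "v \<notin> open_nbhd G v"
  using no_loops' by (auto simp: open_nbhd_def)

lemma closed_nbhd_subset: "v \<in> pverts G \<Longrightarrow> closed_nbhd G v \<subseteq> pverts G"
  using open_nbhd_subset by (simp add: closed_nbhd_def)

lemma closed_nbhd_sym: "u \<in> closed_nbhd G v \<longleftrightarrow> v \<in> closed_nbhd G u"
  by (auto simp: closed_nbhd_def open_nbhd_def arc_sym)

lemma card_closed_nbhd: "card (closed_nbhd G v) = degree G v + 1"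
  by (simp add: closed_nbhd_def degree_def finite_open_nbhd not_in_open_nbhd)

lemma card_closed_nbhd_Int:
  "card (closed_nbhd G v \<inter> S) = card (open_nbhd G v \<inter> S) + (if v \<in> S then 1 else 0)"
  by (simp add: closed_nbhd_def finite_open_nbhd not_in_open_nbhd Int_insert_left)

text \<open>Handshake argument: arcs are mapped to their unordered pairs, and since there are no
  loops, exactly two opposite arcs lie over each edge.\<close>

lemma sum_degree: "(\<Sum>v\<in>pverts G. degree G v) = 2 * graph_size G"
proof -
  define E where "E = {{u, v} | u v. (u, v) \<in> parcs G}"
  have E: "E = (\<lambda>(u, v). {u, v}) ` parcs G"
    by (auto simp: E_def)
  have fibre: "card {a \<in> parcs G. (\<lambda>(u, v). {u, v}) a = e} = 2" if "e \<in> E" for e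
  proof -
    from that obtain u v where e: "e = {u, v}" "(u, v) \<in> parcs G"
      by (auto simp: E_def)
    then have "u \<noteq> v"
      using no_loops' by blast
    moreover have "{a \<in> parcs G. (\<lambda>(u, v). {u, v}) a = e} = {(u, v), (v, u)}"
      using e arc_sym by (auto simp: doubleton_eq_iff)
    ultimately show ?thesis
      by simp
  qed
  have "(\<Sum>v\<in>pverts G. degree G v) = card (SIGMA v:pverts G. open_nbhd G v)"
    by (simp add: degree_def finite_open_nbhd)
  also have "(SIGMA v:pverts G. open_nbhd G v) = parcs G"
    by (auto simp: open_nbhd_def dest: in_arcsD1)
  also have "card (parcs G) = (\<Sum>e\<in>E. card {a \<in> parcs G. (\<lambda>(u, v). {u, v}) a = e})"
    using sum.image_gen[of "parcs G" "\<lambda>_. 1 :: nat" "\<lambda>(u, v). {u, v}"] by (simp add: E)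
  also have "\<dots> = 2 * graph_size G"
    by (simp add: fibre graph_size_def E_def)
  finally show ?thesis .
qed

lemma sum_card_closed_nbhd:
  "(\<Sum>v\<in>pverts G. card (closed_nbhd G v)) = 2 * graph_size G + graph_order G"
  by (simp add: card_closed_nbhd sum_degree sum.distrib graph_order_def del: add_Suc_right)

text \<open>Counts the pairs (v, s) with s in N[v] and in S in two ways; by symmetry, the vertices v
  belonging to a fixed s are those of N[s].\<close>

lemma sum_card_closed_nbhd_Int:
  assumes "S \<subseteq> pverts G"
  shows "(\<Sum>v\<in>pverts G. card (closed_nbhd G v \<inter> S)) = (\<Sum>s\<in>S. card (closed_nbhd G s))"
proof -
  have fin: "finite S"
    using assms finite_subset pair_finite_verts by blast
  have "(\<Sum>v\<in>pverts G. card {s \<in> S. s \<in> closed_nbhd G v})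
      = (\<Sum>s\<in>S. card {v \<in> pverts G. s \<in> closed_nbhd G v})"
    by (rule sum_multicount_gen) (use fin in auto)
  moreover have "{v \<in> pverts G. s \<in> closed_nbhd G v} = closed_nbhd G s" if "s \<in> S" for s
    using that assms closed_nbhd_subset closed_nbhd_sym by blast
  moreover have "{s \<in> S. s \<in> closed_nbhd G v} = closed_nbhd G v \<inter> S" for v
    by blast
  ultimately show ?thesis
    by simp
qed

section \<open>Attainment of the domination and domatic numbers\<close>

lemma finite_tuple_dominating_cards: "finite {card S | S. tuple_dominating k G S}"
proof -
  have "{card S | S. tuple_dominating k G S} \<subseteq> card ` Pow (pverts G)"
    by (auto simp: tuple_dominating_def)
  then show ?thesis
    by (rule finite_subset) simp
qed

lemma tuple_domination_number_le:
  "tuple_dominating k G S \<Longrightarrow> tuple_domination_number k G \<le> card S"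
  unfolding tuple_domination_number_def
  by (rule Min_le[OF finite_tuple_dominating_cards]) blast

lemma finite_tuple_domatic_cards: "finite {card P | P. tuple_domatic_partition k G P}"
proof -
  have "{card P | P. tuple_domatic_partition k G P} \<subseteq> card ` Pow (Pow (pverts G))"
    by (auto simp: tuple_domatic_partition_def tuple_dominating_def)
  then show ?thesis
    by (rule finite_subset) simp
qed

lemma card_le_tuple_domatic_number:
  "tuple_domatic_partition k G P \<Longrightarrow> card P \<le> tuple_domatic_number k G"
  unfolding tuple_domatic_number_def
  by (rule Max_ge[OF finite_tuple_domatic_cards]) blast

text \<open>N[v] lies inside the vertex set and has deg v + 1 \<ge> k elements. This witness shows
  that the sets behind \<open>Min\<close> and \<open>Max\<close> are nonempty.\<close>

lemma tuple_dominating_pverts: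
  assumes "min_degree G \<ge> k - 1"
  shows "tuple_dominating k G (pverts G)"
proof -
  have "k \<le> card (closed_nbhd G v \<inter> pverts G)" if v: "v \<in> pverts G" for v
  proof -
    have "min_degree G \<le> degree G v"
      unfolding min_degree_def using v by simp
    with assms show ?thesis
      using closed_nbhd_subset[OF v] by (simp add: Int_absorb2 card_closed_nbhd)
  qed
  then show ?thesis
    by (simp add: tuple_dominating_def)
qed

lemma tuple_domination_number_attained:
  assumes "min_degree G \<ge> k - 1"
  obtains S where "tuple_dominating k G S" "card S = tuple_domination_number k G"
proof -
  have "tuple_domination_number k G \<in> {card S | S. tuple_dominating k G S}"
    unfolding tuple_domination_number_def
    by (rule Min_in[OF finite_tuple_dominating_cards])
      (use tuple_dominating_pverts[OF assms] in blast)
  then show ?thesis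
    using that by force
qed

lemma tuple_domatic_number_attained:
  assumes "min_degree G \<ge> k - 1" "pverts G \<noteq> {}"
  obtains P where "tuple_domatic_partition k G P" "card P = tuple_domatic_number k G"
proof -
  \<comment> \<open>The one-part partition serves as witness; its part must be nonempty, hence the
    condition on \<open>pverts G\<close>.\<close>
  have "tuple_domatic_partition k G {pverts G}"
    using tuple_dominating_pverts[OF assms(1)] assms(2)
    by (simp add: tuple_domatic_partition_def partition_on_space)
  then have "{card P | P. tuple_domatic_partition k G P} \<noteq> {}"
    by blast
  then have "tuple_domatic_number k G \<in> {card P | P. tuple_domatic_partition k G P}"
    unfolding tuple_domatic_number_def by (rule Max_in[OF finite_tuple_domatic_cards])
  then show ?thesis
    using that by force
qed

section \<open>Closed neighbourhoods against a partition, and the family \<Psi>\<close>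

lemma card_closed_nbhd_partition:
  assumes "partition_on (pverts G) P" "v \<in> pverts G"
  shows "card (closed_nbhd G v) = (\<Sum>S\<in>P. card (closed_nbhd G v \<inter> S))"
  using card_Int_partition_on[OF _ assms(1) closed_nbhd_subset[OF assms(2)]] by simp

text \<open>N[v] splits along the parts into summands of at least k. If the total is only k times
  the number of parts, no summand can exceed k.\<close>

lemma tuple_domatic_partition_card_closed_nbhd:
  assumes "tuple_domatic_partition k G P" "v \<in> pverts G"
  shows "k * card P \<le> card (closed_nbhd G v)"
    and "card (closed_nbhd G v) = k * card P \<Longrightarrow> S \<in> P \<Longrightarrow> card (closed_nbhd G v \<inter> S) = k"
proof -
  have P: "partition_on (pverts G) P" and dom: "\<And>S. S \<in> P \<Longrightarrow> k \<le> card (closed_nbhd G v \<inter> S)"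
    using assms by (auto simp: tuple_domatic_partition_def tuple_dominating_def)
  have fin: "finite P"
    using P pair_finite_verts finite_elements by blast
  note eq = card_closed_nbhd_partition[OF P assms(2)]
  show "k * card P \<le> card (closed_nbhd G v)"
    using sum_mono[of P "\<lambda>_. k"] dom by (simp add: eq mult.commute)
  assume "card (closed_nbhd G v) = k * card P" "S \<in> P"
  then show "card (closed_nbhd G v \<inter> S) = k"
    using sum_mono_inv[of "\<lambda>_. k" P "\<lambda>S. card (closed_nbhd G v \<inter> S)" S] dom fin
    by (simp add: eq mult.commute)
qed

text \<open>Passing to closed neighbourhoods merges two conditions into one: v sees k - 1 neighbours
  plus itself in its own piece and k neighbours in any other piece. Here k \<ge> 1 ensures (k - 1) +
  1 = k.\<close>

lemma Psi_family_iff: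
  assumes "k \<ge> 1"
  shows "G \<in> Psi_family k \<longleftrightarrow>
    (\<exists>P. P \<noteq> {} \<and> partition_on (pverts G) P \<and> (\<forall>S\<in>P. \<forall>T\<in>P. card S = card T) \<and>
       (\<forall>S\<in>P. \<forall>v\<in>pverts G. card (closed_nbhd G v \<inter> S) = k))"
    (is "_ \<longleftrightarrow> (\<exists>P. ?exact P)")
proof
  assume "G \<in> Psi_family k"
  then obtain r H where r: "(r::nat) \<ge> 1"
    and reg: "\<forall>i \<in> {1..r}. regular_graph (k - 1) (H i)"
    and ord: "\<forall>i \<in> {1..r}. \<forall>j \<in> {1..r}. graph_order (H i) = graph_order (H j)"
    and disj: "disjoint_family_on (\<lambda>i. pverts (H i)) {1..r}"
    and V: "pverts G = (\<Union>i \<in> {1..r}. pverts (H i))"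
    and ind: "\<forall>i \<in> {1..r}. parcs G \<inter> (pverts (H i) \<times> pverts (H i)) = parcs (H i)"
    and cross: "\<forall>i \<in> {1..r}. \<forall>j \<in> {1..r}. i \<noteq> j \<longrightarrow>
      (\<forall>v \<in> pverts (H i). card (open_nbhd G v \<inter> pverts (H j)) = k)"
    unfolding Psi_family_def by (elim CollectE conjE exE) (rule that)
  define P where "P = (\<lambda>i. pverts (H i)) ` {1..r}"
  have "P \<noteq> {}"
    using r by (simp add: P_def)
  moreover have "partition_on (pverts G) P"
  proof (rule partition_onI)
    show "\<Union>P = pverts G"
      by (simp add: P_def V)
    show "{} \<notin> P"
      using reg by (auto simp: P_def regular_graph_def)
    show "disjnt S T" if "S \<in> P" "T \<in> P" "S \<noteq> T" for S T
    proof -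
      obtain i j where "i \<in> {1..r}" "S = pverts (H i)" "j \<in> {1..r}" "T = pverts (H j)"
        using \<open>S \<in> P\<close> \<open>T \<in> P\<close> unfolding P_def by blast
      then show ?thesis
        using \<open>S \<noteq> T\<close> disjoint_family_onD[OF disj, of i j] by (auto simp: disjnt_def)
    qed
  qed
  moreover have "\<forall>S\<in>P. \<forall>T\<in>P. card S = card T"
    using ord unfolding P_def graph_order_def by blast
  moreover have "card (closed_nbhd G v \<inter> S) = k" if "S \<in> P" "v \<in> pverts G" for S v
  proof -
    obtain j where j: "j \<in> {1..r}" "S = pverts (H j)"
      using \<open>S \<in> P\<close> by (auto simp: P_def)
    obtain i where i: "i \<in> {1..r}" "v \<in> pverts (H i)"
      using \<open>v \<in> pverts G\<close> V by auto
    show ?thesis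
    proof (cases "i = j")
      case True
      \<comment> \<open>This is where the arcs of G inside a piece being exactly those of that piece
        enters.\<close>
      have "open_nbhd G v \<inter> S = open_nbhd (H i) v"
        using ind[rule_format, OF i(1)] i j True by (auto simp: open_nbhd_def)
      then show ?thesis
        using reg[rule_format, OF i(1)] i j True assms
        by (simp add: card_closed_nbhd_Int regular_graph_def degree_def)
    next
      case False
      then have "v \<notin> S"
        using disjoint_family_onD[OF disj i(1) j(1)] i(2) j(2) by blast
      then show ?thesis
        using cross[rule_format, OF i(1) j(1) False i(2)] j by (simp add: card_closed_nbhd_Int)
    qed
  qed
  ultimately show "\<exists>P. ?exact P"
    by blast
next
  assume "\<exists>P. ?exact P"
  then obtain P where ne: "P \<noteq> {}" and P: "partition_on (pverts G) P"
    and ord: "\<forall>S\<in>P. \<forall>T\<in>P. card S = card T"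
    and ex: "\<forall>S\<in>P. \<forall>v\<in>pverts G. card (closed_nbhd G v \<inter> S) = k"
    by (elim exE conjE) (rule that)
  have fin: "finite P"
    using P pair_finite_verts finite_elements by blast
  then obtain f where f: "bij_betw f {1..card P} P"
    using ex_bij_betw_nat_finite_1 by blast
  \<comment> \<open>The pieces are the subgraphs induced on the parts, numbered from 1 to match the
    index range in \<open>Psi_family\<close>.\<close>
  define H where "H i = \<lparr>pverts = f i, parcs = parcs G \<inter> f i \<times> f i\<rparr>" for i
  have fP: "f i \<in> P" if "i \<in> {1..card P}" for i
    using f that by (auto dest: bij_betwE)
  have sub: "S \<subseteq> pverts G" if "S \<in> P" for S
    using P that by (auto dest: partition_onD1)
  have reg: "regular_graph (k - 1) (H i)" if i: "i \<in> {1..card P}" for i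
  proof -
    have "pair_graph (H i)"
    proof
      show "finite (pverts (H i))"
        using finite_subset[OF sub[OF fP[OF i]] pair_finite_verts] by (simp add: H_def)
      then show "finite (parcs (H i))"
        by (simp add: H_def)
      show "symmetric (with_proj (H i))"
        using arc_sym by (auto simp: symmetric_def H_def sym_def)
    qed (auto simp: H_def dest: no_loops')
    moreover have "f i \<noteq> {}"
      using fP[OF i] P partition_onD3 by fastforce
    moreover have "degree (H i) v = k - 1" if v: "v \<in> f i" for v
    proof -
      have "open_nbhd (H i) v = open_nbhd G v \<inter> f i"
        using v by (auto simp: open_nbhd_def H_def)
      then show ?thesis
        using ex[rule_format, OF fP[OF i], of v] sub[OF fP[OF i]] v
        by (auto simp: degree_def card_closed_nbhd_Int)
    qed
    ultimately show ?thesis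
      by (simp add: regular_graph_def H_def)
  qed
  have disj: "f i \<inter> f j = {}" if "i \<in> {1..card P}" "j \<in> {1..card P}" "i \<noteq> j" for i j
  proof -
    have "f i \<noteq> f j"
      using inj_on_eq_iff[OF bij_betw_imp_inj_on[OF f] that(1,2)] that(3) by blast
    then show ?thesis
      by (rule disjointD[OF partition_onD2[OF P] fP[OF that(1)] fP[OF that(2)]])
  qed
  have cross: "card (open_nbhd G v \<inter> f j) = k"
    if "i \<in> {1..card P}" "j \<in> {1..card P}" "i \<noteq> j" "v \<in> f i" for i j v
  proof -
    have "v \<notin> f j"
      using disj that by blast
    then show ?thesis
      using ex[rule_format, OF fP[OF that(2)], of v] sub[OF fP[OF that(1)]] that(4)
      by (auto simp: card_closed_nbhd_Int)
  qed
  show "G \<in> Psi_family k"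
    unfolding Psi_family_def
  proof (intro CollectI conjI exI[of _ "card P"] exI[of _ H])
    show "pair_graph G"
      by (rule G)
    show "card P \<ge> 1"
      using ne fin by (simp add: Suc_le_eq card_gt_0_iff)
    show "\<forall>i\<in>{1..card P}. \<forall>j\<in>{1..card P}. graph_order (H i) = graph_order (H j)"
      unfolding graph_order_def H_def pair_pre_digraph.select_convs using ord fP by blast
    show "disjoint_family_on (\<lambda>i. pverts (H i)) {1..card P}"
      using disj by (simp add: disjoint_family_on_def H_def)
    show "pverts G = (\<Union>i\<in>{1..card P}. pverts (H i))"
      using f P by (simp add: H_def bij_betw_def partition_onD1)
  qed (use reg cross in \<open>auto simp: H_def\<close>)
qed

section \<open>The two counting bounds and their equality case\<close>

lemma card_partition_order:
  assumes "partition_on (pverts G) P"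
  shows "graph_order G = (\<Sum>S\<in>P. card S)"
proof -
  have "graph_order G = (\<Sum>S\<in>P. card (pverts G \<inter> S))"
    unfolding graph_order_def by (rule card_Int_partition_on[OF _ assms]) simp_all
  also have "\<dots> = (\<Sum>S\<in>P. card S)"
    using partition_onD1[OF assms] by (intro sum.cong) (auto intro: arg_cong[of _ _ card])
  finally show ?thesis .
qed

text \<open>Both bounds come from a maximum partition, one summed over its parts, the other over the
  vertices. The second stays in additive form to avoid truncated subtraction.\<close>

lemma tuple_domatic_number_mult_le:
  assumes "min_degree G \<ge> k - 1" "pverts G \<noteq> {}"
  defines "d \<equiv> tuple_domatic_number k G" and "\<gamma> \<equiv> tuple_domination_number k G"
  shows "d * \<gamma> \<le> graph_order G"
    and "graph_order G * (k * d) \<le> 2 * graph_size G + graph_order G"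
proof -
  obtain P where P: "tuple_domatic_partition k G P" "card P = d"
    using tuple_domatic_number_attained assms by metis
  have "card P * \<gamma> \<le> (\<Sum>S\<in>P. card S)"
    using sum_mono[of P "\<lambda>_. \<gamma>" card] tuple_domination_number_le P(1)
    by (simp add: tuple_domatic_partition_def \<gamma>_def)
  then show "d * \<gamma> \<le> graph_order G"
    using card_partition_order[of P] P by (simp add: tuple_domatic_partition_def)
  show "graph_order G * (k * d) \<le> 2 * graph_size G + graph_order G"
    using sum_mono[of "pverts G" "\<lambda>_. k * d" "\<lambda>v. card (closed_nbhd G v)"]
      tuple_domatic_partition_card_closed_nbhd(1)[OF P(1)] P(2)
    by (simp add: sum_card_closed_nbhd graph_order_def)
qed

lemma Psi_family_if_extremal:
  assumes "k \<ge> 1" "min_degree G \<ge> k - 1" "pverts G \<noteq> {}"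
  defines "d \<equiv> tuple_domatic_number k G" and "\<gamma> \<equiv> tuple_domination_number k G"
  assumes size: "2 * graph_size G + graph_order G = graph_order G * (k * d)"
    and ord: "d = 1 \<or> graph_order G = d * \<gamma>"
  shows "G \<in> Psi_family k"
proof -
  obtain P where P: "tuple_domatic_partition k G P" "card P = d"
    using tuple_domatic_number_attained assms by metis
  have part: "partition_on (pverts G) P"
    using P(1) by (simp add: tuple_domatic_partition_def)
  then have fin: "finite P"
    using pair_finite_verts finite_elements by blast
  have "P \<noteq> {}"
    using part assms(3) by (auto dest: partition_onD1)
  moreover have "card (closed_nbhd G v \<inter> S) = k" if "S \<in> P" "v \<in> pverts G" for S v
  proof -
    \<comment> \<open>The size hypothesis says that the termwise lower bounds have the same sum as
      the neighbourhood sizes, so they agree at every vertex.\<close>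
    have "(\<Sum>v\<in>pverts G. k * card P) = (\<Sum>v\<in>pverts G. card (closed_nbhd G v))"
      using size P(2) by (simp add: sum_card_closed_nbhd graph_order_def)
    then have "k * card P = card (closed_nbhd G v)"
      by (rule sum_mono_inv)
        (use tuple_domatic_partition_card_closed_nbhd(1)[OF P(1)] that in auto)
    then show ?thesis
      using tuple_domatic_partition_card_closed_nbhd(2)[OF P(1) that(2)] that(1) by simp
  qed
  moreover have "card S = card T" if "S \<in> P" "T \<in> P" for S T
    using ord
  proof
    \<comment> \<open>A single part has nothing to be compared with, so \<gamma> may be smaller than
      n here.\<close>
    assume "d = 1"
    then show ?thesis
      using P(2) that by (auto simp: card_1_singleton_iff)
  next
    assume "graph_order G = d * \<gamma>"
    then have eq: "(\<Sum>S\<in>P. \<gamma>) = (\<Sum>S\<in>P. card S)"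
      using card_partition_order[OF part] P(2) by simp
    have "\<gamma> = card S" if "S \<in> P" for S
      by (rule sum_mono_inv[OF eq _ that fin])
        (use P(1) tuple_domination_number_le in \<open>auto simp: tuple_domatic_partition_def \<gamma>_def\<close>)
    then show ?thesis
      using that by metis
  qed
  ultimately show ?thesis
    using Psi_family_iff[OF assms(1)] part by blast
qed

lemma extremal_if_Psi_family:
  assumes "k \<ge> 1" "min_degree G \<ge> k - 1" "pverts G \<noteq> {}" "G \<in> Psi_family k"
  defines "d \<equiv> tuple_domatic_number k G" and "\<gamma> \<equiv> tuple_domination_number k G"
  shows "2 * graph_size G + graph_order G = graph_order G * (k * d)"
    and "graph_order G = d * \<gamma>"
proof -
  obtain P where ne: "P \<noteq> {}" and P: "partition_on (pverts G) P"
    and ord: "\<forall>S\<in>P. \<forall>T\<in>P. card S = card T"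
    and ex: "\<forall>S\<in>P. \<forall>v\<in>pverts G. card (closed_nbhd G v \<inter> S) = k"
    using assms(4) unfolding Psi_family_iff[OF assms(1)] by (elim exE conjE) (rule that)
  have "S \<subseteq> pverts G" if "S \<in> P" for S
    using P that by (auto dest: partition_onD1)
  with ex have dom: "tuple_dominating k G S" if "S \<in> P" for S
    using that by (simp add: tuple_dominating_def)
  then have le_d: "card P \<le> d"
    using card_le_tuple_domatic_number P by (simp add: tuple_domatic_partition_def d_def)
  have pos: "graph_order G > 0"
    using assms(3) by (simp add: graph_order_def card_gt_0_iff)
  have nbhd: "card (closed_nbhd G v) = k * card P" if "v \<in> pverts G" for v
    using card_closed_nbhd_partition[OF P that] ex that by simp
  then have size: "2 * graph_size G + graph_order G = graph_order G * (k * card P)"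
    using sum_card_closed_nbhd by (simp add: graph_order_def)
  \<comment> \<open>The exact degree count caps d by the number of pieces, after cancelling the
    positive factors n and k.\<close>
  have "graph_order G * (k * d) \<le> graph_order G * (k * card P)"
    using tuple_domatic_number_mult_le(2)[OF assms(2,3)] size by (simp add: d_def)
  with pos assms(1) le_d have d: "d = card P"
    by simp
  with size show "2 * graph_size G + graph_order G = graph_order G * (k * d)"
    by simp
  obtain S where S: "tuple_dominating k G S" "card S = \<gamma>"
    using tuple_domination_number_attained[OF assms(2)] \<gamma>_def by metis
  \<comment> \<open>Double counting for a minimum dominating set S: every vertex contributes at
    least k pairs, every element of S exactly k d.\<close>
  have "(\<Sum>v\<in>pverts G. k) \<le> (\<Sum>v\<in>pverts G. card (closed_nbhd G v \<inter> S))"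
    using S(1) by (intro sum_mono) (simp add: tuple_dominating_def)
  also have "\<dots> = (\<Sum>s\<in>S. card (closed_nbhd G s))"
    using S(1) sum_card_closed_nbhd_Int by (simp add: tuple_dominating_def)
  also have "\<dots> = (\<Sum>s\<in>S. k * card P)"
    using S(1) nbhd by (intro sum.cong) (auto simp: tuple_dominating_def)
  finally have "k * graph_order G \<le> k * (d * \<gamma>)"
    using S(2) d by (simp add: graph_order_def ac_simps)
  then have "graph_order G \<le> d * \<gamma>"
    using assms(1) by simp
  then show "graph_order G = d * \<gamma>"
    using tuple_domatic_number_mult_le(1)[OF assms(2,3)] by (simp add: d_def \<gamma>_def)
qed

end

theorem theorem7:
  fixes G :: "'a pair_pre_digraph" and k n m :: nat
  assumes "k \<ge> 1"
    and "pair_graph G" and "pverts G \<noteq> {}"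
    and "n = graph_order G" and "m = graph_size G"
    and "min_degree G \<ge> k - 1"
  shows "real (tuple_domatic_number k G)
           \<le> 1/2 + sqrt (1/4 + (2 * real m - (real k - 1) * real n)
                              / (real k * real (tuple_domination_number k G)))
       \<and> (real (tuple_domatic_number k G)
           = 1/2 + sqrt (1/4 + (2 * real m - (real k - 1) * real n)
                              / (real k * real (tuple_domination_number k G)))
          \<longleftrightarrow> G \<in> Psi_family k)"
proof -
  interpret pair_graph G by fact
  define d where "d = tuple_domatic_number k G"
  define \<gamma> where "\<gamma> = tuple_domination_number k G"
  have d: "d \<ge> 1"
  proof -
    obtain P where P: "tuple_domatic_partition k G P" "card P = d"
      using tuple_domatic_number_attained[OF assms(2,6,3)] d_def by metis
    then have "P \<noteq> {}" "finite P"
      using assms(3) finite_elements[OF pair_finite_verts]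
      by (auto simp: tuple_domatic_partition_def dest: partition_onD1)
    with P(2) show ?thesis
      by (simp add: Suc_le_eq card_gt_0_iff flip: P(2))
  qed
  \<comment> \<open>As k \<ge> 1, the empty set dominates no vertex; thus the later division by k
    \<gamma> is a genuine one.\<close>
  have \<gamma>: "\<gamma> \<ge> 1"
  proof -
    obtain S where S: "tuple_dominating k G S" "card S = \<gamma>"
      using tuple_domination_number_attained[OF assms(2,6)] \<gamma>_def by metis
    then have "S \<noteq> {}" "finite S"
      using assms(1,3) finite_subset[OF _ pair_finite_verts] by (auto simp: tuple_dominating_def)
    with S(2) show ?thesis
      by (simp add: Suc_le_eq card_gt_0_iff flip: S(2))
  qed
  have parts: "d * \<gamma> \<le> n" and size: "n * (k * d) \<le> 2 * m + n"
    using tuple_domatic_number_mult_le[OF assms(2,6,3)] assms(4,5) by (simp_all add: d_def \<gamma>_def)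
  \<comment> \<open>a and b are the slacks in the two counting bounds: a for the degree sum, b for n
    \<ge> d \<gamma> weighted by k (d - 1). With these weights the numerator 2 m - (k - 1) n is
    exactly k \<gamma> d (d - 1) + a + b.\<close>
  define a where "a = real (2 * m + n) - real (n * (k * d))"
  define b where "b = real k * (real d - 1) * (real n - real (d * \<gamma>))"
  have a: "a \<ge> 0" and b: "b \<ge> 0"
    using size parts d by (simp_all add: a_def b_def del: of_nat_add of_nat_mult)
  have ab: "2 * real m - (real k - 1) * real n
      = real d * (real d - 1) * (real k * real \<gamma>) + (a + b)"
    by (simp add: a_def b_def algebra_simps)
  have k\<gamma>: "k > 0" "\<gamma> > 0" "real k * real \<gamma> > 0"
    using assms(1) \<gamma> by simp_all
  define x where "x = (2 * real m - (real k - 1) * real n) / (real k * real \<gamma>)"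
  have x: "x = real d * (real d - 1) + (a + b) / (real k * real \<gamma>)"
    unfolding x_def ab add_divide_distrib using k\<gamma> by (subst nonzero_mult_div_cancel_right) simp_all
  \<comment> \<open>Nonnegative slacks add to zero only if both vanish. The factor d - 1 in b
    produces the alternative d = 1.\<close>
  have "a + b = 0 \<longleftrightarrow> 2 * m + n = n * (k * d) \<and> (d = 1 \<or> n = d * \<gamma>)"
  proof -
    have "a = 0 \<longleftrightarrow> 2 * m + n = n * (k * d)"
      unfolding a_def by (simp del: of_nat_add of_nat_mult)
    moreover have "b = 0 \<longleftrightarrow> d = 1 \<or> n = d * \<gamma>"
      using assms(1) unfolding b_def by (simp del: of_nat_add of_nat_mult)
    ultimately show ?thesis
      using a b by auto
  qed
  also have "\<dots> \<longleftrightarrow> G \<in> Psi_family k"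
    using Psi_family_if_extremal[OF assms(2,1,6,3)] extremal_if_Psi_family[OF assms(2,1,6,3)]
      assms(4,5) unfolding d_def \<gamma>_def by metis
  finally have "real d * (real d - 1) = x \<longleftrightarrow> G \<in> Psi_family k"
    using k\<gamma> by (auto simp: x)
  moreover have "real d * (real d - 1) \<le> x"
    using a b k\<gamma> by (simp add: x)
  ultimately have "real d \<le> 1/2 + sqrt (1/4 + x) \<and>
      (real d = 1/2 + sqrt (1/4 + x) \<longleftrightarrow> G \<in> Psi_family k)"
    by (simp only: le_half_plus_sqrt_iff[OF d])
  then show ?thesis
    by (simp only: x_def d_def \<gamma>_def)
qed

end
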